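(* Let $p$ be a positive integer and suppose $G$ is a simple graph of order $p+2$ not containing $B_p$ as a subgraph. (1) If $p$ is even, then $G$ has size $\mathrm{ex}(p+2,B_p)$ if and only if $G=K_{p+2}-PM$ or $G=\overline{K_1+((p-2)/2)K_2+P_3}$. (2) If $p$ is odd, then $G$ has size $\mathrm{ex}(p+2,B_p)$ if and only if $G=K_1\vee (K_{p+1}-PM)$.
   Context: Graphs are finite and simple; equality of graphs means isomorphism. The book $B_p$ is the graph consisting of $p$ triangles sharing a common edge. For a graph $H$ and positive integer $n$, $\mathrm{ex}(n,H)$ is the maximum number of edges of a simple graph of order $n$ not containing $H$ as a subgraph. $G+H$ denotes the disjoint union, $mH$ the disjoint union of $m$ copies of $H$, $G\vee H$ the join (disjoint union plus all edges between $G$ and $H$), $\overline{G}$ the complement. $K_n$ is the complete graph, $P_t$ the path on $t$ vertices. For even $n$, $K_n-PM$ is the graph obtained from $K_n$ by deleting the edges of a perfect matching, i.e. the complement of $(n/2)K_2$. *)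

theory Defs
  imports Main
begin

text \<open>
  A graph is a pair of a vertex set and a set of edges, each edge being a two-element vertex set.
  The order of \<open>G\<close> is \<open>card (verts G)\<close> and its size is \<open>card (edges G)\<close>.
\<close>

type_synonym 'a graph = "'a set \<times> 'a set set"

abbreviation verts :: "'a graph \<Rightarrow> 'a set" where
  "verts G \<equiv> fst G"

abbreviation edges :: "'a graph \<Rightarrow> 'a set set" where
  "edges G \<equiv> snd G"

definition simple_graph :: "'a graph \<Rightarrow> bool" where
  "simple_graph G \<longleftrightarrow> finite (verts G) \<and> (\<forall>e\<in>edges G. e \<subseteq> verts G \<and> card e = 2)"

definition graph_iso :: "'a graph \<Rightarrow> 'b graph \<Rightarrow> bool" (infix "\<simeq>" 50) where
  "G \<simeq> H \<longleftrightarrow> (\<exists>f. bij_betw f (verts G) (verts H) \<and>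
     (\<forall>u\<in>verts G. \<forall>v\<in>verts G. {u, v} \<in> edges G \<longleftrightarrow> {f u, f v} \<in> edges H))"

definition subgraph :: "'a graph \<Rightarrow> 'a graph \<Rightarrow> bool" where
  "subgraph S G \<longleftrightarrow> simple_graph S \<and> verts S \<subseteq> verts G \<and> edges S \<subseteq> edges G"

text \<open>Subgraphs need not be induced.\<close>

definition contains_copy :: "'a graph \<Rightarrow> 'b graph \<Rightarrow> bool" where
  "contains_copy G H \<longleftrightarrow> (\<exists>S. subgraph S G \<and> S \<simeq> H)"

text \<open>
  Every finite graph has an isomorphic copy on natural numbers, so it suffices to let the
  maximum range over graphs with vertices in \<^typ>\<open>nat\<close>.
\<close>

definition ex_number :: "nat \<Rightarrow> 'b graph \<Rightarrow> nat" where
  "ex_number n H = Max {card (edges F) | F :: nat graph.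
     simple_graph F \<and> card (verts F) = n \<and> \<not> contains_copy F H}"

definition complete_graph :: "nat \<Rightarrow> nat graph" where
  "complete_graph n = ({..<n}, {{u, v} | u v. u < n \<and> v < n \<and> u \<noteq> v})"

definition path_graph :: "nat \<Rightarrow> nat graph" where
  "path_graph t = ({..<t}, {{i, Suc i} | i. Suc i < t})"

text \<open>The \<open>p\<close> triangles of the book are \<open>{0, 1, i}\<close> for \<open>2 \<le> i < p + 2\<close>; they share the edge \<open>{0, 1}\<close>.\<close>

definition book :: "nat \<Rightarrow> nat graph" where
  "book p = ({..<p + 2}, (\<Union>i\<in>{2..<p + 2}. {{0, 1}, {0, i}, {1, i}}))"

definition complement :: "'a graph \<Rightarrow> 'a graph" where
  "complement G = (verts G,
     {{u, v} | u v. u \<in> verts G \<and> v \<in> verts G \<and> u \<noteq> v \<and> {u, v} \<notin> edges G})"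

definition disjoint_union :: "'a graph \<Rightarrow> 'b graph \<Rightarrow> ('a + 'b) graph" (infixl "\<uplus>" 65) where
  "G \<uplus> H = (verts G <+> verts H, (`) Inl ` edges G \<union> (`) Inr ` edges H)"

definition copies :: "nat \<Rightarrow> 'a graph \<Rightarrow> (nat \<times> 'a) graph" where
  "copies m G = ({..<m} \<times> verts G, {Pair i ` e | i e. i < m \<and> e \<in> edges G})"

definition join :: "'a graph \<Rightarrow> 'b graph \<Rightarrow> ('a + 'b) graph" where
  "join G H = (verts (G \<uplus> H),
     edges (G \<uplus> H) \<union> {{Inl u, Inr v} | u v. u \<in> verts G \<and> v \<in> verts H})"

definition perfect_matching :: "'a graph \<Rightarrow> 'a set set \<Rightarrow> bool" where
  "perfect_matching G M \<longleftrightarrow> M \<subseteq> edges G \<and> (\<forall>v\<in>verts G. \<exists>!e. e \<in> M \<and> v \<in> e)"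

definition standard_matching :: "nat \<Rightarrow> nat set set" where
  "standard_matching n = {{2 * i, 2 * i + 1} | i. i < n div 2}"

definition complete_minus_pm :: "nat \<Rightarrow> nat graph" where
  "complete_minus_pm n = (verts (complete_graph n), edges (complete_graph n) - standard_matching n)"

lemma edges_complete_iff:
  "{u, v} \<in> edges (complete_graph n) \<longleftrightarrow> u < n \<and> v < n \<and> u \<noteq> v"
  by (auto simp: complete_graph_def doubleton_eq_iff)

lemma perfect_matching_standard:
  assumes "even n"
  shows "perfect_matching (complete_graph n) (standard_matching n)"
  unfolding perfect_matching_def
proof (intro conjI ballI)
  show "standard_matching n \<subseteq> edges (complete_graph n)"
  proof
    fix e assume "e \<in> standard_matching n"
    then obtain i where "e = {2 * i, 2 * i + 1}" "i < n div 2"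
      by (auto simp: standard_matching_def)
    moreover from this have "2 * i < n" "2 * i + 1 < n" by auto
    ultimately show "e \<in> edges (complete_graph n)"
      by (simp add: edges_complete_iff)
  qed
  fix v assume "v \<in> verts (complete_graph n)"
  then have v: "v < n" by (simp add: complete_graph_def)
  have k: "v div 2 < n div 2" using v assms by presburger
  show "\<exists>!e. e \<in> standard_matching n \<and> v \<in> e"
  proof (rule ex1I[of _ "{2 * (v div 2), 2 * (v div 2) + 1}"], rule conjI)
    show "{2 * (v div 2), 2 * (v div 2) + 1} \<in> standard_matching n"
      unfolding standard_matching_def using k by blast
    have "v = 2 * (v div 2) \<or> v = 2 * (v div 2) + 1" by presburger
    then show "v \<in> {2 * (v div 2), 2 * (v div 2) + 1}" by (simp only: insert_iff empty_iff) simp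
  next
    fix e assume "e \<in> standard_matching n \<and> v \<in> e"
    then obtain i where e: "e = {2 * i, 2 * i + 1}" "v \<in> e"
      by (auto simp: standard_matching_def)
    then have "v div 2 = i" by auto
    with e(1) show "e = {2 * (v div 2), 2 * (v div 2) + 1}" by simp
  qed
qed

lemma edges_complement_iff:
  "{u, v} \<in> edges (complement G) \<longleftrightarrow>
     u \<in> verts G \<and> v \<in> verts G \<and> u \<noteq> v \<and> {u, v} \<notin> edges G"
proof
  assume "{u, v} \<in> edges (complement G)"
  then obtain a b where "{u, v} = {a, b}" "a \<in> verts G" "b \<in> verts G" "a \<noteq> b" "{a, b} \<notin> edges G"
    unfolding complement_def snd_conv by blast
  moreover from this have "u = a \<and> v = b \<or> u = b \<and> v = a" by (simp add: doubleton_eq_iff)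
  ultimately show "u \<in> verts G \<and> v \<in> verts G \<and> u \<noteq> v \<and> {u, v} \<notin> edges G" by metis
next
  assume "u \<in> verts G \<and> v \<in> verts G \<and> u \<noteq> v \<and> {u, v} \<notin> edges G"
  then show "{u, v} \<in> edges (complement G)"
    unfolding complement_def snd_conv by blast
qed

lemma complete_minus_pm_iso:
  assumes "even n"
  shows "complete_minus_pm n \<simeq> complement (copies (n div 2) (complete_graph 2))"
  unfolding graph_iso_def
proof (intro exI[of _ "\<lambda>v. (v div 2, v mod 2)"] conjI ballI)
  let ?f = "\<lambda>v::nat. (v div 2, v mod 2)"
  let ?C = "copies (n div 2) (complete_graph 2)"
  show "bij_betw ?f (verts (complete_minus_pm n)) (verts (complement ?C))"
  proof (rule bij_betw_byWitness[of _ "\<lambda>(i, j). 2 * i + j"])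
    show "?f ` verts (complete_minus_pm n) \<subseteq> verts (complement ?C)"
      using assms by (auto simp: complete_minus_pm_def complete_graph_def complement_def copies_def)
    show "(\<lambda>(i, j). 2 * i + j) ` verts (complement ?C) \<subseteq> verts (complete_minus_pm n)"
      using assms by (auto simp: complete_minus_pm_def complete_graph_def complement_def copies_def)
  qed (auto simp: complement_def copies_def complete_graph_def)
  fix u v assume "u \<in> verts (complete_minus_pm n)" "v \<in> verts (complete_minus_pm n)"
  then have uv: "u < n" "v < n" by (auto simp: complete_minus_pm_def complete_graph_def)
  have m: "{u, v} \<in> standard_matching n \<longleftrightarrow> u \<noteq> v \<and> u div 2 = v div 2"
  proof
    assume "{u, v} \<in> standard_matching n"
    then show "u \<noteq> v \<and> u div 2 = v div 2"
      by (auto simp: standard_matching_def doubleton_eq_iff)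
  next
    assume a: "u \<noteq> v \<and> u div 2 = v div 2"
    then have "\<exists>k. (u = 2 * k \<and> v = 2 * k + 1) \<or> (v = 2 * k \<and> u = 2 * k + 1)"
      by presburger
    then obtain k where k: "(u = 2 * k \<and> v = 2 * k + 1) \<or> (v = 2 * k \<and> u = 2 * k + 1)" ..
    then have "{u, v} = {2 * k, 2 * k + 1}" by auto
    moreover have "k < n div 2" using k uv assms by presburger
    ultimately show "{u, v} \<in> standard_matching n" unfolding standard_matching_def by blast
  qed
  have l: "{u, v} \<in> edges (complete_minus_pm n) \<longleftrightarrow> u div 2 \<noteq> v div 2"
    using uv m by (auto simp: complete_minus_pm_def complete_graph_def doubleton_eq_iff)
  have c: "{?f u, ?f v} \<in> edges ?C \<longleftrightarrow> u \<noteq> v \<and> u div 2 = v div 2"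
  proof
    assume "{?f u, ?f v} \<in> edges ?C"
    then obtain i a b where "{?f u, ?f v} = {(i, a), (i, b)}" "a \<noteq> b"
      by (auto simp: copies_def complete_graph_def)
    then show "u \<noteq> v \<and> u div 2 = v div 2" by (auto simp: doubleton_eq_iff)
  next
    assume a: "u \<noteq> v \<and> u div 2 = v div 2"
    then have "u mod 2 \<noteq> v mod 2" by (metis div_mult_mod_eq)
    then have "{u mod 2, v mod 2} \<in> edges (complete_graph 2)"
      by (simp add: edges_complete_iff)
    moreover have "{?f u, ?f v} = Pair (u div 2) ` {u mod 2, v mod 2}" using a by simp
    moreover have "u div 2 < n div 2" using uv assms by presburger
    ultimately show "{?f u, ?f v} \<in> edges ?C" unfolding copies_def snd_conv by blast
  qed
  have fV: "?f u \<in> verts ?C" "?f v \<in> verts ?C"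
    using uv assms by (auto simp: copies_def complete_graph_def)
  have "?f u = ?f v \<longleftrightarrow> u = v" by (metis Pair_inject div_mult_mod_eq)
  then have "{?f u, ?f v} \<in> edges (complement ?C) \<longleftrightarrow> u \<noteq> v \<and> {?f u, ?f v} \<notin> edges ?C"
    using fV by (simp only: edges_complement_iff) simp
  with l c show "{u, v} \<in> edges (complete_minus_pm n) \<longleftrightarrow> {?f u, ?f v} \<in> edges (complement ?C)"
    by auto
qed

end

theory Submission
  imports Defs
begin

text \<open>
  A graph of order \<open>p + 2\<close> contains \<open>B\<^sub>p\<close> iff two of its vertices are adjacent to all others, that is,
  iff its complement has two isolated vertices. So the extremal graphs are the complements of the
  graphs of order \<open>n = p + 2\<close> with as few edges as possible among those with at most one isolated
  vertex. Their degree sum is at least \<open>n - 1\<close>, hence they have \<open>n div 2\<close> edges, and this leaves only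
  three degree sequences: all degrees \<open>1\<close>; one \<open>0\<close> and otherwise \<open>1\<close>; one \<open>0\<close>, one \<open>2\<close> and otherwise
  \<open>1\<close>.
\<close>

section \<open>Graph isomorphism\<close>

lemma finite_edges: "simple_graph G \<Longrightarrow> finite (edges G)"
  unfolding simple_graph_def by (meson PowI finite_Pow_iff finite_subset subsetI)

lemma simple_graph_edgeE:
  assumes "simple_graph G" "e \<in> edges G"
  obtains u v where "e = {u, v}" "u \<noteq> v" "u \<in> verts G" "v \<in> verts G"
  using assms unfolding simple_graph_def by (metis card_2_iff insert_subset)

lemma simple_graph_edgeD:
  assumes "simple_graph G" "{u, v} \<in> edges G"
  shows "u \<noteq> v" "u \<in> verts G" "v \<in> verts G"
  using assms unfolding simple_graph_def by (fastforce simp: card_insert_if)+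

lemma simple_graph_edge_vertexE:
  assumes "simple_graph G" "e \<in> edges G" "v \<in> e"
  obtains u where "e = {u, v}" "u \<noteq> v" "u \<in> verts G"
  using simple_graph_edgeE[OF assms(1,2)] assms(3) by (metis insert_commute insertE singletonD)

lemma graph_isoI:
  assumes "bij_betw f (verts G) (verts H)"
    and "\<And>u v. u \<in> verts G \<Longrightarrow> v \<in> verts G \<Longrightarrow> {u, v} \<in> edges G \<longleftrightarrow> {f u, f v} \<in> edges H"
  shows "G \<simeq> H"
  using assms unfolding graph_iso_def by blast

lemma graph_iso_sym:
  assumes "G \<simeq> H"
  shows "H \<simeq> G"
proof -
  obtain f where f: "bij_betw f (verts G) (verts H)"
    "\<And>u v. u \<in> verts G \<Longrightarrow> v \<in> verts G \<Longrightarrow> {u, v} \<in> edges G \<longleftrightarrow> {f u, f v} \<in> edges H"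
    using assms unfolding graph_iso_def by blast
  let ?g = "inv_into (verts G) f"
  have "?g x \<in> verts G" "f (?g x) = x" if "x \<in> verts H" for x
    using that f(1) by (auto simp: bij_betw_def inv_into_into f_inv_into_f)
  with f(2) show ?thesis
    by (intro graph_isoI[of ?g] bij_betw_inv_into f(1)) simp
qed

lemma graph_iso_trans [trans]:
  assumes "G \<simeq> H" "H \<simeq> K"
  shows "G \<simeq> K"
proof -
  obtain f where f: "bij_betw f (verts G) (verts H)"
    "\<And>u v. u \<in> verts G \<Longrightarrow> v \<in> verts G \<Longrightarrow> {u, v} \<in> edges G \<longleftrightarrow> {f u, f v} \<in> edges H"
    using assms unfolding graph_iso_def by blast
  obtain g where g: "bij_betw g (verts H) (verts K)"
    "\<And>u v. u \<in> verts H \<Longrightarrow> v \<in> verts H \<Longrightarrow> {u, v} \<in> edges H \<longleftrightarrow> {g u, g v} \<in> edges K"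
    using assms unfolding graph_iso_def by blast
  have "f x \<in> verts H" if "x \<in> verts G" for x
    using that f(1) by (auto simp: bij_betw_def)
  with f(2) g(2) show ?thesis
    by (intro graph_isoI[of "g \<circ> f"] bij_betw_trans[OF f(1) g(1)]) simp
qed

lemma graph_iso_right_cong: "H \<simeq> K \<Longrightarrow> G \<simeq> H \<longleftrightarrow> G \<simeq> K"
  using graph_iso_trans[of G H K] graph_iso_trans[of G K H] graph_iso_sym[of H K] by blast

text \<open>\<open>graph_iso\<close> constrains only pairs of vertices. Simplicity of both graphs
  makes every edge such a pair, so taking images under \<open>f\<close> is a bijection between the
  edge sets.\<close>

lemma graph_iso_card_edges:
  assumes "G \<simeq> H" "simple_graph G" "simple_graph H"
  shows "card (edges G) = card (edges H)"
proof -
  obtain f where f: "bij_betw f (verts G) (verts H)"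
    "\<And>u v. u \<in> verts G \<Longrightarrow> v \<in> verts G \<Longrightarrow> {u, v} \<in> edges G \<longleftrightarrow> {f u, f v} \<in> edges H"
    using assms unfolding graph_iso_def by blast
  have inj: "inj_on ((`) f) (edges G)"
    using f(1) assms(2) unfolding bij_betw_def simple_graph_def
    by (meson PowI inj_on_image_Pow inj_on_subset subsetI)
  have "(`) f ` edges G = edges H"
  proof (intro equalityI subsetI)
    fix e assume "e \<in> (`) f ` edges G"
    then obtain e' where e': "e' \<in> edges G" "e = f ` e'" by blast
    with assms(2) obtain u v where "e' = {u, v}" "u \<in> verts G" "v \<in> verts G"
      by (metis simple_graph_edgeE)
    with e' f(2) show "e \<in> edges H" by simp
  next
    fix e assume e: "e \<in> edges H"
    with assms(3) obtain x y where xy: "e = {x, y}" "x \<in> verts H" "y \<in> verts H"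
      by (metis simple_graph_edgeE)
    with f(1) obtain u v where "u \<in> verts G" "v \<in> verts G" "x = f u" "y = f v"
      unfolding bij_betw_def by blast
    with f(2) e xy have "{u, v} \<in> edges G" "e = f ` {u, v}" by auto
    then show "e \<in> (`) f ` edges G" by blast
  qed
  with inj show ?thesis by (metis card_image)
qed

section \<open>Complements\<close>

lemma verts_complement [simp]: "verts (complement G) = verts G"
  by (simp add: complement_def)

lemma simple_graph_complement: "simple_graph G \<Longrightarrow> simple_graph (complement G)"
  unfolding simple_graph_def by (auto simp: complement_def)

lemma complement_complement:
  assumes "simple_graph G"
  shows "complement (complement G) = G"
proof (rule prod_eqI)
  show "edges (complement (complement G)) = edges G"
  proof (intro equalityI subsetI)
    fix e assume e: "e \<in> edges (complement (complement G))"
    moreover obtain u v where "e = {u, v}"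
      using e simple_graph_edgeE[OF simple_graph_complement[OF simple_graph_complement[OF assms]]]
      by metis
    ultimately show "e \<in> edges G" by (auto simp: edges_complement_iff)
  next
    fix e assume e: "e \<in> edges G"
    with assms obtain u v where "e = {u, v}" by (metis simple_graph_edgeE)
    with e assms show "e \<in> edges (complement (complement G))"
      by (auto simp: edges_complement_iff dest: simple_graph_edgeD)
  qed
qed simp

lemma graph_iso_complement:
  assumes "G \<simeq> H"
  shows "complement G \<simeq> complement H"
proof -
  obtain f where f: "bij_betw f (verts G) (verts H)"
    "\<And>u v. u \<in> verts G \<Longrightarrow> v \<in> verts G \<Longrightarrow> {u, v} \<in> edges G \<longleftrightarrow> {f u, f v} \<in> edges H"
    using assms unfolding graph_iso_def by blast
  have "f u = f v \<longleftrightarrow> u = v" "f u \<in> verts H" if "u \<in> verts G" "v \<in> verts G" for u v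
    using that f(1) by (auto simp: bij_betw_def inj_on_eq_iff)
  with f show ?thesis
    by (intro graph_isoI[of f]) (simp_all add: edges_complement_iff)
qed

text \<open>Moves the classification from \<open>G\<close> to its sparse complement, where degrees
  can be counted.\<close>

lemma graph_iso_complement_iff:
  assumes "simple_graph G" "simple_graph H"
  shows "G \<simeq> complement H \<longleftrightarrow> complement G \<simeq> H"
  using assms by (metis complement_complement graph_iso_complement)

text \<open>The two edge sets partition the two-element subsets of the vertex set.\<close>

lemma card_edges_complement:
  assumes "simple_graph G"
  shows "card (edges G) + card (edges (complement G)) = card (verts G) choose 2"
proof -
  have fin: "finite (verts G)" using assms by (simp add: simple_graph_def)
  have "edges G \<inter> edges (complement G) = {}" by (auto simp: complement_def)
  moreover have "edges G \<union> edges (complement G) = {e. e \<subseteq> verts G \<and> card e = 2}"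
    using assms by (auto simp: complement_def simple_graph_def card_2_iff)
  ultimately show ?thesis
    using n_subsets[OF fin, of 2] finite_edges[OF assms]
      finite_edges[OF simple_graph_complement[OF assms]]
    by (metis card_Un_disjoint)
qed

section \<open>Degrees\<close>

text \<open>Counting incident edges rather than neighbours makes the degree sum a double count of
  incidences and lets degree one be read as unique existence of an edge, as in
  \<open>perfect_matching\<close>.\<close>

definition degree :: "'a graph \<Rightarrow> 'a \<Rightarrow> nat" where
  "degree G v = card {e \<in> edges G. v \<in> e}"

text \<open>Handshake lemma: each edge is counted once at each of its two ends.\<close>

lemma sum_degree:
  assumes "simple_graph G"
  shows "(\<Sum>v\<in>verts G. degree G v) = 2 * card (edges G)"
proof -
  have fin: "finite (verts G)" using assms by (simp add: simple_graph_def)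
  have "{v \<in> verts G. v \<in> e} = e" "card e = 2" if "e \<in> edges G" for e
    using that assms by (auto simp: simple_graph_def)
  then have "(\<Sum>v\<in>verts G. card {e \<in> edges G. v \<in> e}) = (\<Sum>e\<in>edges G. 2)"
    using fin finite_edges[OF assms] by (intro sum_multicount_gen) auto
  then show ?thesis by (simp add: degree_def)
qed

lemma degree_0_iff: "simple_graph G \<Longrightarrow> degree G v = 0 \<longleftrightarrow> (\<forall>u. {u, v} \<notin> edges G)"
proof -
  assume G: "simple_graph G"
  \<comment> \<open>Finiteness of the edge set rules out the value \<open>0\<close> that
    \<open>card\<close> takes on infinite sets.\<close>
  then have "degree G v = 0 \<longleftrightarrow> (\<forall>e\<in>edges G. v \<notin> e)"
    using finite_edges[OF G] by (auto simp: degree_def)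
  also have "\<dots> \<longleftrightarrow> (\<forall>u. {u, v} \<notin> edges G)"
    using simple_graph_edge_vertexE[OF G] by blast
  finally show ?thesis .
qed

lemma degree_complement_0_iff:
  assumes "simple_graph G" "v \<in> verts G"
  shows "degree (complement G) v = 0 \<longleftrightarrow> (\<forall>u\<in>verts G - {v}. {u, v} \<in> edges G)"
  using assms by (auto simp: degree_0_iff simple_graph_complement edges_complement_iff)

lemma degree_1_iff: "degree G v = 1 \<longleftrightarrow> (\<exists>!e. e \<in> edges G \<and> v \<in> e)"
proof
  let ?E = "{e \<in> edges G. v \<in> e}"
  assume "degree G v = 1"
  then obtain e where e: "?E = {e}" unfolding degree_def by (rule card_1_singletonE)
  show "\<exists>!e. e \<in> edges G \<and> v \<in> e"
  proof
    show "e \<in> edges G \<and> v \<in> e" using e by blast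
    show "d = e" if "d \<in> edges G \<and> v \<in> d" for d
      using that singletonD[of d e, folded e] by blast
  qed
next
  let ?E = "{e \<in> edges G. v \<in> e}"
  assume "\<exists>!e. e \<in> edges G \<and> v \<in> e"
  then obtain e where e: "e \<in> edges G \<and> v \<in> e" "\<forall>d. d \<in> edges G \<and> v \<in> d \<longrightarrow> d = e"
    by (rule ex1E)
  have "?E = {e}"
  proof (intro equalityI subsetI)
    show "d \<in> {e}" if "d \<in> ?E" for d using that e(2) by simp
    show "d \<in> ?E" if "d \<in> {e}" for d using that e(1) by simp
  qed
  then show "degree G v = 1" by (simp add: degree_def)
qed

section \<open>Books of full order\<close>

text \<open>The spine edge \<open>{0, 1}\<close> comes only with a page, so \<open>p \<ge> 1\<close>
  guarantees that it is present.\<close>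

lemma edges_book_iff:
  "p \<ge> 1 \<Longrightarrow> {x, y} \<in> edges (book p) \<longleftrightarrow> x \<noteq> y \<and> x < p + 2 \<and> y < p + 2 \<and> (x < 2 \<or> y < 2)"
proof
  assume "p \<ge> 1" "{x, y} \<in> edges (book p)"
  then show "x \<noteq> y \<and> x < p + 2 \<and> y < p + 2 \<and> (x < 2 \<or> y < 2)"
    unfolding book_def by (auto simp: doubleton_eq_iff)
next
  assume p: "p \<ge> 1" and "x \<noteq> y \<and> x < p + 2 \<and> y < p + 2 \<and> (x < 2 \<or> y < 2)"
  \<comment> \<open>\<open>i\<close> names a page containing the edge: the larger end if that is a
    page vertex, and page \<open>2\<close> for the spine edge.\<close>
  moreover define i where "i = max (max x y) 2"
  ultimately have "x = 0 \<and> y = 1 \<or> x = 1 \<and> y = 0 \<or> x < 2 \<and> y = i \<or> x = i \<and> y < 2"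
    and i: "i \<in> {2..<p + 2}"
    by auto
  then have "{x, y} \<in> {{0, 1}, {0, i}, {1, i}}" by (auto simp: less_2_cases_iff)
  with i show "{x, y} \<in> edges (book p)" unfolding book_def snd_conv by (rule UN_I)
qed

text \<open>A book on \<open>p + 2\<close> vertices must span \<open>G\<close>, so its two spine
  vertices are adjacent to all others. Conversely, two such vertices serve as a spine, with the
  remaining \<open>p\<close> vertices as pages in any order.\<close>

lemma contains_book_iff:
  assumes "p \<ge> 1" "simple_graph G" "card (verts G) = p + 2"
  shows "contains_copy G (book p) \<longleftrightarrow> (\<exists>u\<in>verts G. \<exists>v\<in>verts G. u \<noteq> v \<and>
    degree (complement G) u = 0 \<and> degree (complement G) v = 0)"
proof
  assume "contains_copy G (book p)"
  then obtain S f where S: "subgraph S G" and f: "bij_betw f (verts S) (verts (book p))"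
    "\<And>u v. u \<in> verts S \<Longrightarrow> v \<in> verts S \<Longrightarrow> {u, v} \<in> edges S \<longleftrightarrow> {f u, f v} \<in> edges (book p)"
    unfolding contains_copy_def graph_iso_def by blast
  have bv: "verts (book p) = {..<p + 2}" by (simp add: book_def)
  have fin: "finite (verts G)" using assms by (simp add: simple_graph_def)
  have "card (verts S) = p + 2" using bij_betw_same_card[OF f(1)] bv by simp
  with S assms(3) fin have VS: "verts S = verts G" by (metis card_subset_eq subgraph_def)
  \<comment> \<open>The vertices mapped below \<open>2\<close> are the spine of the copy.\<close>
  have univ: "degree (complement G) w = 0" if w: "w \<in> verts G" "f w < 2" for w
  proof -
    have "{u, w} \<in> edges G" if u: "u \<in> verts G" "u \<noteq> w" for u
    proof -
      have "f u < p + 2" "f w < p + 2" "f u \<noteq> f w"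
        using f(1) u w VS bv by (auto simp: bij_betw_def inj_on_eq_iff)
      then have "{u, w} \<in> edges S"
        using f(2)[of u w] VS u w edges_book_iff[OF assms(1)] by simp
      then show ?thesis using S by (auto simp: subgraph_def)
    qed
    then show ?thesis using degree_complement_0_iff[OF assms(2) w(1)] by blast
  qed
  have "0 \<in> f ` verts G" "1 \<in> f ` verts G"
    using f(1) VS bv by (simp_all add: bij_betw_def)
  then obtain u v where uv: "u \<in> verts G" "v \<in> verts G" "f u = 0" "f v = 1"
    by (metis imageE)
  then show "\<exists>u\<in>verts G. \<exists>v\<in>verts G. u \<noteq> v \<and>
    degree (complement G) u = 0 \<and> degree (complement G) v = 0"
    using univ[of u] univ[of v] by (intro bexI[of _ u] bexI[of _ v]) auto
next
  assume "\<exists>u\<in>verts G. \<exists>v\<in>verts G. u \<noteq> v \<and>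
    degree (complement G) u = 0 \<and> degree (complement G) v = 0"
  then obtain u v where uv: "u \<in> verts G" "v \<in> verts G" "u \<noteq> v"
    and adj: "\<And>x. x \<in> verts G \<Longrightarrow> x \<noteq> u \<Longrightarrow> {x, u} \<in> edges G"
      "\<And>x. x \<in> verts G \<Longrightarrow> x \<noteq> v \<Longrightarrow> {x, v} \<in> edges G"
    using degree_complement_0_iff[OF assms(2)] by (metis DiffI singletonD)
  have fin: "finite (verts G)" using assms by (simp add: simple_graph_def)
  have "card (verts G - {u, v}) = card {2..<p + 2}"
    using uv fin assms(3) by simp
  then obtain g where g: "bij_betw g (verts G - {u, v}) {2..<p + 2}"
    using fin by (metis finite_Diff finite_atLeastLessThan finite_same_card_bij)
  define f where "f x = (if x = u then 0 else if x = v then 1 else g x)" for x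
  have "bij_betw f (verts G - {u, v}) {2..<p + 2}"
    using g by (subst bij_betw_cong[of _ f g]) (auto simp: f_def)
  moreover have "bij_betw f {u, v} {0, 1}"
    using uv by (auto simp: f_def bij_betw_def)
  ultimately have "bij_betw f (verts G - {u, v} \<union> {u, v}) ({2..<p + 2} \<union> {0, 1})"
    by (intro bij_betw_combine) auto
  moreover have "verts G - {u, v} \<union> {u, v} = verts G" using uv by auto
  moreover have "{2..<p + 2} \<union> {0, 1} = verts (book p)" by (auto simp: book_def)
  ultimately have bij: "bij_betw f (verts G) (verts (book p))" by simp
  \<comment> \<open>Edges between page vertices are dropped, since the isomorphism to the book must
    also preserve non-adjacency.\<close>
  define S where "S = (verts G, {e \<in> edges G. u \<in> e \<or> v \<in> e})"
  have "subgraph S G" using assms(2) by (auto simp: subgraph_def S_def simple_graph_def)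
  moreover have "S \<simeq> book p"
  proof (rule graph_isoI[of f])
    show "bij_betw f (verts S) (verts (book p))" using bij by (simp add: S_def)
    fix x y assume "x \<in> verts S" "y \<in> verts S"
    then have xy: "x \<in> verts G" "y \<in> verts G" by (simp_all add: S_def)
    then have "f x < p + 2" "f y < p + 2" "f x = f y \<longleftrightarrow> x = y"
      using bij by (auto simp: bij_betw_def inj_on_eq_iff book_def)
    moreover have low: "f z < 2 \<longleftrightarrow> z = u \<or> z = v" if "z \<in> verts G" for z
    proof (cases "z = u \<or> z = v")
      case False
      with that g have "g z \<in> {2..<p + 2}" by (intro bij_betwE[OF g, rule_format]) auto
      with False show ?thesis by (simp add: f_def)
    qed (auto simp: f_def)
    moreover have "{x, y} \<in> edges S \<longleftrightarrow> x \<noteq> y \<and> (x = u \<or> x = v \<or> y = u \<or> y = v)"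
      using xy adj[of x] adj[of y] simple_graph_edgeD[OF assms(2), of x y]
        adj[of y, unfolded insert_commute[of y]]
      by (auto simp: S_def)
    ultimately show "{x, y} \<in> edges S \<longleftrightarrow> {f x, f y} \<in> edges (book p)"
      using xy by (simp add: edges_book_iff[OF assms(1)] low)
  qed
  ultimately show "contains_copy G (book p)" unfolding contains_copy_def by blast
qed

section \<open>The extremal number\<close>

text \<open>With at most one isolated vertex, the degree sum of a graph on \<open>n\<close> vertices
  is at least \<open>n - 1\<close>, and it is twice the size.\<close>

lemma card_edges_ge:
  assumes "simple_graph H"
    and "\<And>u v. u \<in> verts H \<Longrightarrow> v \<in> verts H \<Longrightarrow> degree H u = 0 \<Longrightarrow> degree H v = 0 \<Longrightarrow> u = v"
  shows "card (verts H) div 2 \<le> card (edges H)"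
proof -
  let ?Z = "{v \<in> verts H. degree H v = 0}"
  have fin: "finite (verts H)" using assms by (simp add: simple_graph_def)
  have "card ?Z \<le> 1"
    unfolding One_nat_def using assms(2) fin by (subst card_le_Suc0_iff_eq) auto
  then have "card (verts H) - 1 \<le> card (verts H - ?Z)"
    using fin by (subst card_Diff_subset) auto
  also have "\<dots> = (\<Sum>v\<in>verts H - ?Z. 1)" by simp
  also have "\<dots> \<le> (\<Sum>v\<in>verts H - ?Z. degree H v)"
    by (rule sum_mono) auto
  also have "\<dots> \<le> (\<Sum>v\<in>verts H. degree H v)"
    using fin by (intro sum_mono2) auto
  also have "\<dots> = 2 * card (edges H)" by (rule sum_degree[OF assms(1)])
  \<comment> \<open>From \<open>n - 1 \<le> 2 * m\<close> follows \<open>n div 2 \<le> m\<close>: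
    for even positive \<open>n\<close> the even number \<open>2 * m\<close> cannot equal
    \<open>n - 1\<close>.\<close>
  finally show ?thesis by linarith
qed

section \<open>Sharpness of the edge bound\<close>

lemma card_standard_matching: "card (standard_matching n) = n div 2"
proof -
  have "standard_matching n = (\<lambda>i. {2 * i, 2 * i + 1}) ` {..<n div 2}"
    by (auto simp: standard_matching_def)
  moreover have "inj_on (\<lambda>i. {2 * i, 2 * i + 1 :: nat}) {..<n div 2}"
    by (auto simp: inj_on_def doubleton_eq_iff)
  ultimately show ?thesis by (simp add: card_image)
qed

lemma simple_graph_complete: "simple_graph (complete_graph n)"
  by (auto simp: simple_graph_def complete_graph_def)

lemma simple_graph_complete_minus_pm: "simple_graph (complete_minus_pm n)"
  using simple_graph_complete[of n] by (auto simp: simple_graph_def complete_minus_pm_def)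

lemma complement_complete_minus_pm:
  "complement (complete_minus_pm n) = ({..<n}, standard_matching n)"
proof -
  have "simple_graph ({..<n}, standard_matching n)"
    by (fastforce simp: simple_graph_def standard_matching_def)
  moreover have "complete_minus_pm n = complement ({..<n}, standard_matching n)"
    by (auto simp: complete_minus_pm_def complement_def complete_graph_def)
  ultimately show ?thesis by (simp add: complement_complement)
qed

text \<open>For odd \<open>n\<close>, \<^term>\<open>complete_minus_pm n\<close> lacks a matching that misses only the vertex \<open>n - 1\<close>.\<close>

lemma complete_minus_pm_book_free:
  assumes "p \<ge> 1"
  shows "\<not> contains_copy (complete_minus_pm (p + 2)) (book p)"
proof -
  let ?n = "p + 2"
  \<comment> \<open>Every vertex below \<open>?n - 1\<close> is covered by its block
    \<open>{2 * k, 2 * k + 1}\<close> with \<open>k = v div 2\<close>, so at most one vertex is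
    isolated in the complement, whatever the parity.\<close>
  have "v = ?n - 1" if v: "v < ?n" "degree (complement (complete_minus_pm ?n)) v = 0" for v
  proof (rule ccontr)
    assume "v \<noteq> ?n - 1"
    then have k: "v div 2 < ?n div 2" using v(1) by linarith
    let ?e = "{2 * (v div 2), 2 * (v div 2) + 1}"
    have "?e \<in> standard_matching ?n" unfolding standard_matching_def using k by blast
    moreover have "\<exists>u. ?e = {u, v}"
      by (cases "even v") (force elim!: evenE oddE)+
    ultimately show False
      using v(2) simple_graph_complement[OF simple_graph_complete_minus_pm[of ?n]]
      by (auto simp: degree_0_iff complement_complete_minus_pm)
  qed
  then show ?thesis
    by (subst contains_book_iff[OF assms simple_graph_complete_minus_pm])
      (auto simp: complete_minus_pm_def complete_graph_def)
qed

text \<open>Passing to complements turns the lower bound \<open>card_edges_ge\<close> into an upper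
  bound, which \<open>complete_minus_pm (p + 2)\<close> attains for both parities of
  \<open>p\<close>.\<close>

lemma ex_number_book:
  assumes "p \<ge> 1"
  shows "ex_number (p + 2) (book p) = (p + 2 choose 2) - (p + 2) div 2"
  unfolding ex_number_def
proof (rule Max_eqI)
  let ?A = "{card (edges F) | F :: nat graph.
    simple_graph F \<and> card (verts F) = p + 2 \<and> \<not> contains_copy F (book p)}"
  have le: "card (edges F) \<le> (p + 2 choose 2) - (p + 2) div 2"
    if F: "simple_graph F" "card (verts F) = p + 2" "\<not> contains_copy F (book p)" for F :: "nat graph"
    using card_edges_ge[OF simple_graph_complement[OF F(1)]] card_edges_complement[OF F(1)]
      F(2,3) contains_book_iff[OF assms F(1,2)]
    by fastforce
  then show le': "y \<le> (p + 2 choose 2) - (p + 2) div 2" if "y \<in> ?A" for y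
    using that by blast
  \<comment> \<open>\<open>Max\<close> is meaningful only on a finite set; the bound just shown
    makes it finite.\<close>
  then show "finite ?A" by (meson finite_nat_set_iff_bounded_le)
  let ?K = "complete_minus_pm (p + 2)"
  have "card (verts ?K) = p + 2" by (simp add: complete_minus_pm_def complete_graph_def)
  moreover from this have "card (edges ?K) = (p + 2 choose 2) - (p + 2) div 2"
    using card_edges_complement[OF simple_graph_complete_minus_pm[of "p + 2"]]
    by (simp add: complement_complete_minus_pm card_standard_matching)
  ultimately show "(p + 2 choose 2) - (p + 2) div 2 \<in> ?A"
    using complete_minus_pm_book_free[OF assms] simple_graph_complete_minus_pm
    by (metis (mono_tags, lifting) mem_Collect_eq)
qed

section \<open>Disjoint unions, copies and joins\<close>

lemma edges_disjoint_union_iff [simp]: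
  "{Inl u, Inl v} \<in> edges (G \<uplus> H) \<longleftrightarrow> {u, v} \<in> edges G"
  "{Inr x, Inr y} \<in> edges (G \<uplus> H) \<longleftrightarrow> {x, y} \<in> edges H"
  "{Inl u, Inr y} \<notin> edges (G \<uplus> H)"
  "{Inr y, Inl u} \<notin> edges (G \<uplus> H)"
proof -
  have "Inl ` {u, v} \<in> edges (G \<uplus> H) \<longleftrightarrow> {u, v} \<in> edges G"
    and "Inr ` {x, y} \<in> edges (G \<uplus> H) \<longleftrightarrow> {x, y} \<in> edges H"
    unfolding disjoint_union_def snd_conv Un_iff image_iff[of _ "(`) _"]
    by (simp_all only: inj_image_eq_iff[OF inj_Inl] inj_image_eq_iff[OF inj_Inr]) auto
  then show "{Inl u, Inl v} \<in> edges (G \<uplus> H) \<longleftrightarrow> {u, v} \<in> edges G"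
    "{Inr x, Inr y} \<in> edges (G \<uplus> H) \<longleftrightarrow> {x, y} \<in> edges H"
    by simp_all
  show "{Inl u, Inr y} \<notin> edges (G \<uplus> H)" "{Inr y, Inl u} \<notin> edges (G \<uplus> H)"
    unfolding disjoint_union_def by auto
qed

text \<open>The singleton rules serve the case of equal vertices, in which \<open>{x, x}\<close>
  collapses.\<close>

lemma edges_join_iff [simp]:
  "{Inl u, Inl v} \<in> edges (join G H) \<longleftrightarrow> {u, v} \<in> edges G"
  "{Inr x, Inr y} \<in> edges (join G H) \<longleftrightarrow> {x, y} \<in> edges H"
  "{Inl u, Inr y} \<in> edges (join G H) \<longleftrightarrow> u \<in> verts G \<and> y \<in> verts H"
  "{Inr y, Inl u} \<in> edges (join G H) \<longleftrightarrow> u \<in> verts G \<and> y \<in> verts H"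
  "{Inl u} \<in> edges (join G H) \<longleftrightarrow> {u} \<in> edges G"
  "{Inr x} \<in> edges (join G H) \<longleftrightarrow> {x} \<in> edges H"
  using edges_disjoint_union_iff(1)[of u u G H] edges_disjoint_union_iff(2)[of x x G H]
  unfolding join_def by (auto simp: doubleton_eq_iff)

lemma verts_disjoint_union [simp]: "verts (G \<uplus> H) = verts G <+> verts H"
  and verts_join [simp]: "verts (join G H) = verts G <+> verts H"
  by (simp_all add: disjoint_union_def join_def)

lemma simple_graph_disjoint_union:
  "simple_graph G \<Longrightarrow> simple_graph H \<Longrightarrow> simple_graph (G \<uplus> H)"
  unfolding simple_graph_def by (auto simp: disjoint_union_def card_image)

lemma card_edges_disjoint_union:
  fixes G :: "'a graph" and H :: "'b graph"
  assumes "simple_graph G" "simple_graph H"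
  shows "card (edges (G \<uplus> H)) = card (edges G) + card (edges H)"
proof -
  \<comment> \<open>The empty set is the only set that could lie in both image families.\<close>
  have "e \<noteq> {}" if "e \<in> edges G" for e
    using that assms(1) by (auto simp: simple_graph_def)
  then have "(`) Inl ` edges G \<inter> (`) Inr ` edges H = {}" by blast
  moreover have "card ((`) (Inl :: 'a \<Rightarrow> 'a + 'b) ` edges G) = card (edges G)"
    "card ((`) (Inr :: 'b \<Rightarrow> 'a + 'b) ` edges H) = card (edges H)"
    by (auto intro!: card_image simp: inj_on_def inj_image_eq_iff)
  ultimately show ?thesis
    using finite_edges[OF assms(1)] finite_edges[OF assms(2)]
    by (simp add: disjoint_union_def card_Un_disjoint)
qed

lemma simple_graph_copies: "simple_graph G \<Longrightarrow> simple_graph (copies m G)"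
  unfolding simple_graph_def copies_def by (fastforce simp: card_image inj_on_def)

lemma edges_copies_iff:
  "{(i, u), (j, v)} \<in> edges (copies m G) \<longleftrightarrow> i = j \<and> i < m \<and> {u, v} \<in> edges G"
proof
  assume "{(i, u), (j, v)} \<in> edges (copies m G)"
  then obtain k e where e: "{(i, u), (j, v)} = Pair k ` e" "k < m" "e \<in> edges G"
    by (auto simp: copies_def)
  \<comment> \<open>Projecting away the copy index recovers the original edge.\<close>
  have "snd ` Pair k ` e = e" by (simp add: image_image)
  then have "{u, v} = e" unfolding e(1)[symmetric] by simp
  moreover have "(i, u) \<in> Pair k ` e" "(j, v) \<in> Pair k ` e" using e(1) by auto
  ultimately show "i = j \<and> i < m \<and> {u, v} \<in> edges G" using e(2,3) by auto
next
  assume "i = j \<and> i < m \<and> {u, v} \<in> edges G"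
  moreover from this have "{(i, u), (j, v)} = Pair i ` {u, v}" by simp
  ultimately show "{(i, u), (j, v)} \<in> edges (copies m G)" unfolding copies_def snd_conv by blast
qed

text \<open>Cross pairs are never edges of a disjoint union, so all of them are edges of its
  complement; inside each part the two constructions agree.\<close>

lemma complement_disjoint_union_iso:
  "complement (G \<uplus> H) \<simeq> join (complement G) (complement H)"
  by (rule graph_isoI[of id])
    (auto simp: edges_complement_iff edges_complement_iff[of u u for u, simplified])

lemma join_cong:
  assumes "G \<simeq> G'" "H \<simeq> H'"
  shows "join G H \<simeq> join G' H'"
proof -
  obtain f where f: "bij_betw f (verts G) (verts G')"
    "\<And>u v. u \<in> verts G \<Longrightarrow> v \<in> verts G \<Longrightarrow> {u, v} \<in> edges G \<longleftrightarrow> {f u, f v} \<in> edges G'"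
    using assms unfolding graph_iso_def by blast
  obtain g where g: "bij_betw g (verts H) (verts H')"
    "\<And>u v. u \<in> verts H \<Longrightarrow> v \<in> verts H \<Longrightarrow> {u, v} \<in> edges H \<longleftrightarrow> {g u, g v} \<in> edges H'"
    using assms unfolding graph_iso_def by blast
  have "f u \<in> verts G'" if "u \<in> verts G" for u using that f(1) by (auto simp: bij_betw_def)
  moreover have "g u \<in> verts H'" if "u \<in> verts H" for u using that g(1) by (auto simp: bij_betw_def)
  moreover have "bij_betw (map_sum f g) (verts G <+> verts H) (verts G' <+> verts H')"
    unfolding bij_betw_def
  proof
    show "inj_on (map_sum f g) (verts G <+> verts H)"
      using f(1) g(1) unfolding bij_betw_def inj_on_def by (elim conjE) (intro ballI, elim PlusE; simp)
    have "map_sum f g ` (verts G <+> verts H) = f ` verts G <+> g ` verts H"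
      by (simp add: Plus_def image_Un image_image)
    then show "map_sum f g ` (verts G <+> verts H) = verts G' <+> verts H'"
      using f(1) g(1) by (simp add: bij_betw_def)
  qed
  ultimately show ?thesis
    by (intro graph_isoI[of "map_sum f g"]; simp) (elim PlusE; simp add: f(2) g(2))
qed

section \<open>Recognising graphs by their degrees\<close>

text \<open>Intersecting with \<open>verts G\<close> keeps this a subgraph of a simple
  \<open>G\<close> for every set \<open>A\<close>.\<close>

definition induced :: "'a graph \<Rightarrow> 'a set \<Rightarrow> 'a graph" where
  "induced G A = (verts G \<inter> A, {e \<in> edges G. e \<subseteq> A})"

lemma simple_graph_induced: "simple_graph G \<Longrightarrow> simple_graph (induced G A)"
  by (auto simp: simple_graph_def induced_def)

text \<open>Since no edge crosses the partition, isomorphisms of the two sides glue to one, tagged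
  by \<open>Inl\<close> and \<open>Inr\<close>. The recognition lemmas below use it to split off
  components.\<close>

lemma induced_disjoint_union_iso:
  assumes V: "A \<union> B = verts G" "A \<inter> B = {}"
    and E: "\<And>e. e \<in> edges G \<Longrightarrow> e \<subseteq> A \<or> e \<subseteq> B"
    and "induced G A \<simeq> X" "induced G B \<simeq> Y"
  shows "G \<simeq> X \<uplus> Y"
proof -
  have VA: "verts (induced G A) = A" "verts (induced G B) = B" using V by (auto simp: induced_def)
  obtain f where f: "bij_betw f A (verts X)"
    "\<And>u v. u \<in> A \<Longrightarrow> v \<in> A \<Longrightarrow> {u, v} \<in> edges G \<longleftrightarrow> {f u, f v} \<in> edges X"
    using assms(4) unfolding graph_iso_def VA by (auto simp: induced_def)
  obtain g where g: "bij_betw g B (verts Y)"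
    "\<And>u v. u \<in> B \<Longrightarrow> v \<in> B \<Longrightarrow> {u, v} \<in> edges G \<longleftrightarrow> {g u, g v} \<in> edges Y"
    using assms(5) unfolding graph_iso_def VA by (auto simp: induced_def)
  define h where "h x = (if x \<in> A then Inl (f x) else Inr (g x))" for x
  have hA: "h x = Inl (f x)" if "x \<in> A" for x using that by (simp add: h_def)
  have hB: "h x = Inr (g x)" if "x \<in> B" for x using that V(2) by (auto simp: h_def)
  have "bij_betw h A (Inl ` verts X)" "bij_betw h B (Inr ` verts Y)"
    using f(1) g(1) hA hB by (auto simp: bij_betw_def inj_on_def image_iff)
  then have "bij_betw h (verts G) (verts (X \<uplus> Y))"
    using V(1) bij_betw_combine[of h A "Inl ` verts X" B "Inr ` verts Y"]
    by (auto simp: Plus_def)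
  then show ?thesis
  proof (rule graph_isoI)
    fix u v assume "u \<in> verts G" "v \<in> verts G"
    then consider "u \<in> A" "v \<in> A" | "u \<in> A" "v \<in> B" | "u \<in> B" "v \<in> A" | "u \<in> B" "v \<in> B"
      using V(1) by blast
    then show "{u, v} \<in> edges G \<longleftrightarrow> {h u, h v} \<in> edges (X \<uplus> Y)"
      using f(2)[of u v] g(2)[of u v] E[of "{u, v}"] V(2)
      by cases (auto simp: hA hB)
  qed
qed

text \<open>Number the edges and name the two ends of each: edge \<open>i\<close> becomes copy
  \<open>i\<close> of \<open>K_2\<close>. The edges are pairwise disjoint and cover all vertices, so
  this is a bijection on vertices.\<close>

lemma perfect_matching_iso:
  assumes "simple_graph H" and "perfect_matching H (edges H)"
  shows "H \<simeq> copies (card (edges H)) (complete_graph 2)"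
proof -
  let ?m = "card (edges H)"
  obtain h where h: "bij_betw h {..<?m} (edges H)"
    using ex_bij_betw_nat_finite[OF finite_edges[OF assms(1)]] by (auto simp: atLeast0LessThan)
  then have hE: "h i \<in> edges H" if "i < ?m" for i using that by (auto simp: bij_betw_def)
  have "\<exists>a b. h i = {a, b} \<and> a \<noteq> b" if "i < ?m" for i
    using simple_graph_edgeE[OF assms(1) hE[OF that]] by metis
  then obtain a b where ab: "\<And>i. i < ?m \<Longrightarrow> h i = {a i, b i}" "\<And>i. i < ?m \<Longrightarrow> a i \<noteq> b i"
    by metis
  have uniq: "i = j" if "i < ?m" "j < ?m" "x \<in> h i" "x \<in> h j" for i j x
  proof -
    have "x \<in> verts H" using hE[OF that(1)] that(3) assms(1) by (auto simp: simple_graph_def)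
    then have "h i = h j" using assms(2) that hE unfolding perfect_matching_def by blast
    then show ?thesis using inj_onD[OF bij_betw_imp_inj_on[OF h]] that(1,2) by simp
  qed
  \<comment> \<open>The map goes from the standard copies to \<open>H\<close>, where it has an
    explicit formula; symmetry of isomorphism reverses it at the end.\<close>
  define f where "f = (\<lambda>(i, j::nat). if j = 0 then a i else b i)"
  have fh: "f (i, j) \<in> h i" if "i < ?m" for i j using ab(1)[OF that] by (simp add: f_def)
  have V: "verts (copies ?m (complete_graph 2)) = {..<?m} \<times> {..<2}"
    by (simp add: copies_def complete_graph_def)
  have "copies ?m (complete_graph 2) \<simeq> H"
  proof (rule graph_isoI[of f])
    show "bij_betw f (verts (copies ?m (complete_graph 2))) (verts H)"
      unfolding V bij_betw_def
    proof (intro conjI equalityI subsetI inj_onI)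
      fix x y assume xy: "x \<in> {..<?m} \<times> {..<2::nat}" "y \<in> {..<?m} \<times> {..<2::nat}" "f x = f y"
      obtain i j i' j' where p: "x = (i, j)" "y = (i', j')" by fastforce
      then have "i = i'" using uniq[of i i' "f x"] fh xy by auto
      moreover from this have "j = j'"
        using p xy ab(2)[of i] by (auto simp: f_def less_2_cases_iff split: if_splits)
      ultimately show "x = y" using p by simp
    next
      fix x assume "x \<in> f ` ({..<?m} \<times> {..<2})"
      then obtain i j where "i < ?m" "x = f (i, j)" by auto
      then show "x \<in> verts H" using fh hE assms(1) by (fastforce simp: simple_graph_def)
    next
      fix x assume "x \<in> verts H"
      then obtain e where "e \<in> edges H" "x \<in> e" using assms(2) unfolding perfect_matching_def by blast
      then obtain i where i: "i < ?m" "x \<in> h i" using h unfolding bij_betw_def by blast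
      then have "x = f (i, 0) \<or> x = f (i, 1)" using ab(1) by (auto simp: f_def)
      with i(1) show "x \<in> f ` ({..<?m} \<times> {..<2})" by auto
    qed
    fix x y assume "x \<in> verts (copies ?m (complete_graph 2))" "y \<in> verts (copies ?m (complete_graph 2))"
    then obtain i j k l where x: "x = (i, j)" "i < ?m" "j < 2" and y: "y = (k, l)" "k < ?m" "l < 2"
      unfolding V by auto
    \<comment> \<open>An edge is some \<open>h n\<close>, and disjointness of the edges forces both
      copy indices to equal \<open>n\<close>.\<close>
    have "{f x, f y} \<in> edges H \<longleftrightarrow> i = k \<and> j \<noteq> l"
    proof
      assume e: "{f x, f y} \<in> edges H"
      then obtain n where n: "n < ?m" "{f x, f y} = h n"
        using h unfolding bij_betw_def by (metis imageE lessThan_iff)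
      then have "f x \<in> h n" "f y \<in> h n" by auto
      then have "i = n" "k = n"
        using uniq[OF x(2) n(1), of "f x"] uniq[OF y(2) n(1), of "f y"] fh[OF x(2)] fh[OF y(2)]
        by (simp_all add: x(1) y(1))
      moreover have "f x \<noteq> f y" using simple_graph_edgeD(1)[OF assms(1) e] .
      ultimately show "i = k \<and> j \<noteq> l" using x y by auto
    next
      assume "i = k \<and> j \<noteq> l"
      moreover from this have "j = 0 \<and> l = 1 \<or> j = 1 \<and> l = 0"
        using x(3) y(3) by linarith
      ultimately have "{f x, f y} = h i"
        using ab(1)[OF x(2)] by (auto simp: x(1) y(1) f_def)
      then show "{f x, f y} \<in> edges H" using hE x by simp
    qed
    then show "{x, y} \<in> edges (copies ?m (complete_graph 2)) \<longleftrightarrow> {f x, f y} \<in> edges H"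
      using x y by (simp add: edges_copies_iff edges_complete_iff)
  qed
  then show ?thesis by (rule graph_iso_sym)
qed

text \<open>All degrees are one, so the handshake lemma counts the vertices. It expresses the number
  of copies through the order of the graph.\<close>

lemma perfect_matching_card:
  assumes "simple_graph H" and "perfect_matching H (edges H)"
  shows "card (verts H) = 2 * card (edges H)"
proof -
  have "(\<Sum>v\<in>verts H. degree H v) = (\<Sum>v\<in>verts H. 1)"
    using assms(2) by (intro sum.cong refl) (simp only: degree_1_iff perfect_matching_def)
  then show ?thesis using sum_degree[OF assms(1)] by simp
qed

lemma induced_singleton_iso:
  assumes "simple_graph H" "v \<in> verts H"
  shows "induced H {v} \<simeq> complete_graph 1"
proof (rule graph_isoI[of "\<lambda>_. 0"])
  show "bij_betw (\<lambda>_. 0) (verts (induced H {v})) (verts (complete_graph 1))"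
    using assms(2) by (auto simp: induced_def complete_graph_def bij_betw_def)
  fix x y assume "x \<in> verts (induced H {v})" "y \<in> verts (induced H {v})"
  then show "{x, y} \<in> edges (induced H {v}) \<longleftrightarrow> {0, 0} \<in> edges (complete_graph 1)"
    using simple_graph_edgeD(1)[OF assms(1), of v v] by (auto simp: induced_def complete_graph_def)
qed

text \<open>The isolated vertex is a component of its own, and on the remaining vertices the edges
  form a perfect matching.\<close>

lemma isolated_matching_iso:
  assumes "simple_graph H" "v \<in> verts H" "degree H v = 0"
    and "\<And>w. w \<in> verts H - {v} \<Longrightarrow> degree H w = 1"
  shows "H \<simeq> complete_graph 1 \<uplus> copies ((card (verts H) - 1) div 2) (complete_graph 2)"
proof (rule induced_disjoint_union_iso[of "{v}" "verts H - {v}"])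
  let ?I = "induced H (verts H - {v})"
  have E: "e \<subseteq> verts H - {v}" if "e \<in> edges H" for e
    using assms(1,3) that by (auto simp: simple_graph_def degree_def finite_edges[OF assms(1)])
  then show "\<And>e. e \<in> edges H \<Longrightarrow> e \<subseteq> {v} \<or> e \<subseteq> verts H - {v}" by blast
  \<comment> \<open>Removing \<open>v\<close> loses no edge, so the degree conditions carry over
    unchanged.\<close>
  have I: "?I = (verts H - {v}, edges H)" using E by (auto simp: induced_def)
  have sI: "simple_graph ?I" by (rule simple_graph_induced[OF assms(1)])
  have pm: "perfect_matching ?I (edges ?I)"
    using assms(4) unfolding I perfect_matching_def degree_1_iff by simp
  have "card (edges ?I) = (card (verts H) - 1) div 2"
    using perfect_matching_card[OF sI pm] assms(1,2) unfolding I by (simp add: simple_graph_def)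
  with perfect_matching_iso[OF sI pm]
  show "?I \<simeq> copies ((card (verts H) - 1) div 2) (complete_graph 2)" by simp
  show "induced H {v} \<simeq> complete_graph 1" by (rule induced_singleton_iso[OF assms(1,2)])
  show "{v} \<union> (verts H - {v}) = verts H" using assms(2) by blast
qed simp

text \<open>The two neighbours of \<open>c\<close> have degree one, so they form with
  \<open>c\<close> a path that is a whole component. The other vertices fall under
  \<open>isolated_matching_iso\<close>.\<close>

lemma isolated_matching_path_iso:
  assumes "simple_graph H" "v \<in> verts H" "degree H v = 0"
    and c: "c \<in> verts H" "degree H c = 2"
    and deg1: "\<And>w. w \<in> verts H - {v, c} \<Longrightarrow> degree H w = 1"
  shows "H \<simeq> complete_graph 1 \<uplus> copies ((card (verts H) - 4) div 2) (complete_graph 2) \<uplus> path_graph 3"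
proof -
  have fin: "finite (verts H)" using assms(1) by (simp add: simple_graph_def)
  obtain e e' where ee: "{d \<in> edges H. c \<in> d} = {e, e'}" "e \<noteq> e'"
    using c(2) unfolding degree_def by (metis card_2_iff)
  obtain a where a: "e = {a, c}" "a \<noteq> c" "a \<in> verts H"
    using ee(1) simple_graph_edge_vertexE[OF assms(1), of e c] by blast
  obtain b where b: "e' = {b, c}" "b \<noteq> c" "b \<in> verts H"
    using ee(1) simple_graph_edge_vertexE[OF assms(1), of e' c] by blast
  have ab: "a \<noteq> b" using a b ee by auto
  have eE: "{a, c} \<in> edges H" "{b, c} \<in> edges H" using a b ee by auto
  have nov: "v \<notin> d" if "d \<in> edges H" for d
    using assms(3) that finite_edges[OF assms(1)] by (auto simp: degree_def)
  \<comment> \<open>As \<open>v\<close> lies on no edge, it stays outside the path; hence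
    \<open>a\<close> and \<open>b\<close> have degree one.\<close>
  have distinct: "v \<noteq> a" "v \<noteq> b" "v \<noteq> c" using nov[OF eE(1)] nov[OF eE(2)] by auto
  have ca: "d = {a, c}" if "d \<in> edges H" "a \<in> d" for d
    using deg1[of a] a distinct eE(1) that unfolding degree_1_iff by blast
  have cb: "d = {b, c}" if "d \<in> edges H" "b \<in> d" for d
    using deg1[of b] b distinct eE(2) that unfolding degree_1_iff by blast
  have cc: "d = {a, c} \<or> d = {b, c}" if "d \<in> edges H" "c \<in> d" for d
    using ee(1) a b that by blast
  let ?W = "{a, b, c}"
  let ?R = "verts H - ?W"
  \<comment> \<open>No edge leaves the path: an edge meeting it is one of its own two.\<close>
  have touch: "d = {a, c} \<or> d = {b, c} \<or> d \<subseteq> ?R" if "d \<in> edges H" for d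
  proof (cases "d \<inter> ?W = {}")
    case True
    then show ?thesis using that assms(1) by (auto simp: simple_graph_def)
  next
    case False
    then show ?thesis using ca[OF that] cb[OF that] cc[OF that] by blast
  qed
  show ?thesis
  proof (rule induced_disjoint_union_iso[of ?R ?W])
    let ?I = "induced H ?R"
    have VI: "verts ?I = ?R" by (auto simp: induced_def)
    have sI: "simple_graph ?I" by (rule simple_graph_induced[OF assms(1)])
    have deg: "degree ?I w = degree H w" if "w \<in> ?R" for w
    proof -
      have "{d \<in> edges ?I. w \<in> d} = {d \<in> edges H. w \<in> d}"
        using touch that by (auto simp: induced_def)
      then show ?thesis by (simp add: degree_def)
    qed
    have "?I \<simeq> complete_graph 1 \<uplus> copies ((card (verts ?I) - 1) div 2) (complete_graph 2)"
      using deg deg1 assms(2,3) distinct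
      by (intro isolated_matching_iso[of _ v] sI) (auto simp: VI)
    \<comment> \<open>With three vertices removed, the \<open>- 1\<close> for the isolated vertex
      turns into the \<open>- 4\<close> of the claim.\<close>
    moreover have "card (verts ?I) = card (verts H) - 3"
      using fin a b c ab unfolding VI by (subst card_Diff_subset) auto
    ultimately show "?I \<simeq> complete_graph 1 \<uplus> copies ((card (verts H) - 4) div 2) (complete_graph 2)"
      by simp
    show "\<And>d. d \<in> edges H \<Longrightarrow> d \<subseteq> ?R \<or> d \<subseteq> ?W" using touch by blast
    \<comment> \<open>The vertex of degree two goes to \<open>1\<close>, the middle of the
      path.\<close>
    define f where "f x = (if x = a then 0 else if x = c then 1 else 2 :: nat)" for x
    show "induced H ?W \<simeq> path_graph 3"
    proof (rule graph_isoI[of f])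
      have "verts (induced H ?W) = ?W" using a b c by (auto simp: induced_def)
      moreover have "verts (path_graph 3) = {0, 1, 2}" by (auto simp: path_graph_def)
      ultimately show "bij_betw f (verts (induced H ?W)) (verts (path_graph 3))"
        using a b ab by (auto simp: bij_betw_def f_def)
      fix x y assume "x \<in> verts (induced H ?W)" "y \<in> verts (induced H ?W)"
      then have xy: "x \<in> ?W" "y \<in> ?W" by (auto simp: induced_def)
      have "edges (path_graph 3) = {{0, 1}, {1, 2}}"
        by (auto simp: path_graph_def numeral_3_eq_3 less_Suc_eq)
      moreover have "edges (induced H ?W) = {{a, c}, {b, c}}"
      proof (intro equalityI subsetI)
        fix d assume "d \<in> edges (induced H ?W)"
        then have d: "d \<in> edges H" "d \<subseteq> ?W" by (simp_all add: induced_def)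
        then have "d \<noteq> {}" using assms(1) by (auto simp: simple_graph_def)
        with d(2) have "\<not> d \<subseteq> ?R" by blast
        with touch[OF d(1)] show "d \<in> {{a, c}, {b, c}}" by blast
      next
        fix d assume "d \<in> {{a, c}, {b, c}}"
        with eE show "d \<in> edges (induced H ?W)" by (auto simp: induced_def)
      qed
      ultimately show "{x, y} \<in> edges (induced H ?W) \<longleftrightarrow> {f x, f y} \<in> edges (path_graph 3)"
        using xy a b ab by (auto simp: f_def doubleton_eq_iff)
    qed
  qed (use a b c in auto)
qed

text \<open>Measure the excess, the sum of \<open>degree H w - 1\<close> over the non-isolated
  vertices. With \<open>n\<close> vertices and no isolated one it is
  \<open>2 * (n div 2) - n\<close>, forcing \<open>n\<close> even and excess zero. With one isolated
  vertex it is \<open>2 * (n div 2) - (n - 1)\<close>: one for even \<open>n\<close>, zero for odd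
  \<open>n\<close>.\<close>

lemma minimal_graph_cases:
  assumes "simple_graph H"
    and isolated: "\<And>u v. u \<in> verts H \<Longrightarrow> v \<in> verts H \<Longrightarrow> degree H u = 0 \<Longrightarrow> degree H v = 0 \<Longrightarrow> u = v"
    and size: "card (edges H) = card (verts H) div 2"
  shows "even (card (verts H)) \<Longrightarrow> H \<simeq> copies (card (verts H) div 2) (complete_graph 2) \<or>
      H \<simeq> complete_graph 1 \<uplus> copies ((card (verts H) - 4) div 2) (complete_graph 2) \<uplus> path_graph 3"
    and "odd (card (verts H)) \<Longrightarrow>
      H \<simeq> complete_graph 1 \<uplus> copies ((card (verts H) - 1) div 2) (complete_graph 2)"
proof -
  let ?n = "card (verts H)"
  have fin: "finite (verts H)" using assms(1) by (simp add: simple_graph_def)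
  \<comment> \<open>Degrees on \<open>A\<close> are nonzero, so the truncated subtraction is
    exact.\<close>
  have excess: "(\<Sum>w\<in>A. degree H w - 1) + card A = (\<Sum>w\<in>A. degree H w)"
    if "\<And>w. w \<in> A \<Longrightarrow> degree H w \<noteq> 0" for A
  proof -
    have "(\<Sum>w\<in>A. degree H w - 1) + card A = (\<Sum>w\<in>A. (degree H w - 1) + 1)"
      by (simp only: sum.distrib) simp
    also have "\<dots> = (\<Sum>w\<in>A. degree H w)" using that by (intro sum.cong) auto
    finally show ?thesis .
  qed
  have total: "(\<Sum>w\<in>verts H. degree H w) = 2 * (?n div 2)"
    using sum_degree[OF assms(1)] size by simp
  consider (none) "\<And>w. w \<in> verts H \<Longrightarrow> degree H w \<noteq> 0"
    | (one) v where "v \<in> verts H" "degree H v = 0"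
    by blast
  then have "(even ?n \<longrightarrow> H \<simeq> copies (?n div 2) (complete_graph 2) \<or>
      H \<simeq> complete_graph 1 \<uplus> copies ((?n - 4) div 2) (complete_graph 2) \<uplus> path_graph 3) \<and>
    (odd ?n \<longrightarrow> H \<simeq> complete_graph 1 \<uplus> copies ((?n - 1) div 2) (complete_graph 2))"
  proof cases
    case none
    from excess[OF none] total
    have s: "(\<Sum>w\<in>verts H. degree H w - 1) + ?n = 2 * (?n div 2)" by simp
    \<comment> \<open>For odd \<open>?n\<close> the right-hand side would be \<open>?n - 1\<close>,
      less than the left.\<close>
    then have ev: "even ?n" by presburger
    with s have "(\<Sum>w\<in>verts H. degree H w - 1) = 0"
      by (metis add_cancel_left_left dvd_mult_div_cancel)
    then have z: "\<forall>w\<in>verts H. degree H w - 1 = 0"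
      by (simp only: sum_eq_0_iff[OF fin])
    have "degree H w = 1" if "w \<in> verts H" for w
      using bspec[OF z that] none[OF that] by linarith
    then have "perfect_matching H (edges H)"
      unfolding degree_1_iff perfect_matching_def by blast
    from perfect_matching_iso[OF assms(1) this] ev size show ?thesis by simp
  next
    case one
    let ?A = "verts H - {v}"
    have nz: "degree H w \<noteq> 0" if "w \<in> ?A" for w using isolated one that by blast
    have cA: "card ?A + 1 = ?n" using fin one(1) card_Suc_Diff1 by fastforce
    have "(\<Sum>w\<in>verts H. degree H w) = (\<Sum>w\<in>?A. degree H w)"
      using fin one by (simp add: sum.remove)
    with excess[of ?A, OF nz] total cA
    have s: "(\<Sum>w\<in>?A. degree H w - 1) + (?n - 1) = 2 * (?n div 2)" by linarith
    show ?thesis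
    proof (cases "even ?n")
      case True
      \<comment> \<open>Total excess one is carried by a single vertex, which then has degree two
        and becomes the centre of the path.\<close>
      have "(\<Sum>w\<in>?A. degree H w - 1) = Suc 0"
        using s cA dvd_mult_div_cancel[OF True] by linarith
      then obtain c where c: "c \<in> ?A" "degree H c - 1 = Suc 0"
        "\<And>w. w \<in> ?A \<Longrightarrow> c \<noteq> w \<Longrightarrow> degree H w - 1 = 0"
        using fin by (auto simp: sum_eq_Suc0_iff)
      have "degree H w = 1" if "w \<in> verts H - {v, c}" for w
      proof -
        have "w \<in> ?A" "c \<noteq> w" using that by auto
        from c(3)[OF this] nz[OF this(1)] show ?thesis by linarith
      qed
      moreover have "degree H c = 2" using c(2) by simp
      ultimately show ?thesis
        using isolated_matching_path_iso[OF assms(1) one, of c] c(1) True by blast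
    next
      case False
      with s have "(\<Sum>w\<in>?A. degree H w - 1) = 0"
        by (metis add_cancel_left_left odd_two_times_div_two_nat)
      then have z: "\<forall>w\<in>?A. degree H w - 1 = 0"
        by (simp only: sum_eq_0_iff[OF finite_Diff[OF fin]])
      have "degree H w = 1" if "w \<in> ?A" for w
        using bspec[OF z that] nz[OF that] by linarith
      with isolated_matching_iso[OF assms(1) one] False show ?thesis by blast
    qed
  qed
  then show "even ?n \<Longrightarrow> H \<simeq> copies (?n div 2) (complete_graph 2) \<or>
      H \<simeq> complete_graph 1 \<uplus> copies ((?n - 4) div 2) (complete_graph 2) \<uplus> path_graph 3"
    "odd ?n \<Longrightarrow> H \<simeq> complete_graph 1 \<uplus> copies ((?n - 1) div 2) (complete_graph 2)"
    by blast+
qed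

section \<open>Sizes and complements of the candidate graphs\<close>

lemma card_edges_copies_complete_2: "card (edges (copies m (complete_graph 2))) = m"
proof -
  have K2: "edges (complete_graph 2) = {{0, 1}}"
    by (auto simp: complete_graph_def less_2_cases_iff)
  have "edges (copies m (complete_graph 2)) = (\<lambda>i. {(i, 0), (i, 1)}) ` {..<m}"
    unfolding copies_def K2 by auto
  moreover have "inj_on (\<lambda>i. {(i, 0), (i, 1 :: nat)}) {..<m}"
    by (auto simp: inj_on_def doubleton_eq_iff)
  ultimately show ?thesis by (simp add: card_image)
qed

lemma simple_graph_path: "simple_graph (path_graph t)"
  by (auto simp: simple_graph_def path_graph_def)

lemma card_edges_path_3: "card (edges (path_graph 3)) = 2"
proof -
  have "edges (path_graph 3) = {{0, 1}, {1, 2}}"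
    by (auto simp: path_graph_def numeral_3_eq_3 less_Suc_eq)
  then show ?thesis by (simp add: doubleton_eq_iff)
qed

lemma complete_graph_1: "edges (complete_graph 1) = {}"
  by (auto simp: complete_graph_def)

text \<open>Complementing the union gives the join of the complements; \<open>K_1\<close> is its own
  complement, and the matching turns into \<open>complete_minus_pm n\<close>.\<close>

lemma join_complete_minus_pm_iso:
  assumes "even n"
  shows "join (complete_graph 1) (complete_minus_pm n) \<simeq>
    complement (complete_graph 1 \<uplus> copies (n div 2) (complete_graph 2))"
proof (rule graph_iso_sym)
  let ?M = "copies (n div 2) (complete_graph 2)"
  have "complement (complete_graph 1 \<uplus> ?M) \<simeq>
      join (complement (complete_graph 1)) (complement ?M)"
    by (rule complement_disjoint_union_iso)
  also have "\<dots> \<simeq> join (complete_graph 1) (complete_minus_pm n)"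
  proof (rule join_cong)
    show "complement (complete_graph 1) \<simeq> complete_graph 1"
      by (rule graph_isoI[of id])
        (auto simp: edges_complement_iff edges_complement_iff[of u u for u, simplified]
          complete_graph_def[of "Suc 0"])
    show "complement ?M \<simeq> complete_minus_pm n"
      by (rule graph_iso_sym[OF complete_minus_pm_iso[OF assms]])
  qed
  finally show "complement (complete_graph 1 \<uplus> ?M) \<simeq> join (complete_graph 1) (complete_minus_pm n)" .
qed

theorem theorem4:
  fixes p :: nat and G :: "'a graph"
  assumes "p \<ge> 1"
    and "simple_graph G"
    and "card (verts G) = p + 2"
    and "\<not> contains_copy G (book p)"
  shows "(even p \<longrightarrow>
           (card (edges G) = ex_number (p + 2) (book p) \<longleftrightarrow>
             G \<simeq> complete_minus_pm (p + 2) \<or>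
             G \<simeq> complement
                  (complete_graph 1 \<uplus> copies ((p - 2) div 2) (complete_graph 2) \<uplus> path_graph 3)))
       \<and> (odd p \<longrightarrow>
           (card (edges G) = ex_number (p + 2) (book p) \<longleftrightarrow>
             G \<simeq> join (complete_graph 1) (complete_minus_pm (p + 1))))"
proof -
  let ?H = "complement G"
  let ?M = "\<lambda>m. copies m (complete_graph 2)"
  let ?P = "complete_graph 1 \<uplus> ?M ((p - 2) div 2) \<uplus> path_graph 3"
  have sH: "simple_graph ?H" by (rule simple_graph_complement[OF assms(2)])
  have isolated: "u = v"
    if "u \<in> verts ?H" "v \<in> verts ?H" "degree ?H u = 0" "degree ?H v = 0" for u v
    using that contains_book_iff[OF assms(1-3)] assms(4) unfolding verts_complement by blast
  have sM: "simple_graph (?M m)" for m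
    by (intro simple_graph_copies simple_graph_complete)
  have sK: "simple_graph (complete_graph 1 \<uplus> ?M m)" for m
    by (intro simple_graph_disjoint_union simple_graph_complete sM)
  have sP: "simple_graph ?P"
    by (intro simple_graph_disjoint_union sK simple_graph_path)
  have cK: "card (edges (complete_graph 1 \<uplus> ?M m)) = m" for m
    by (simp only: card_edges_disjoint_union[OF simple_graph_complete sM] complete_graph_1
        card_edges_copies_complete_2 card.empty add_0)
  have cP: "card (edges ?P) = (p - 2) div 2 + 2"
    by (simp only: card_edges_disjoint_union[OF sK simple_graph_path] cK card_edges_path_3)
  have "(p + 2) div 2 \<le> card (edges ?H)"
    using card_edges_ge[OF sH] isolated assms(3) by simp
  \<comment> \<open>The sizes of \<open>G\<close> and \<open>?H\<close> add up to a constant, so a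
    maximal \<open>G\<close> means a minimal \<open>?H\<close>. The lower bound on the size of
    \<open>?H\<close> ensures that the subtraction in the extremal number is not truncated.\<close>
  then have size: "card (edges G) = ex_number (p + 2) (book p) \<longleftrightarrow> card (edges ?H) = (p + 2) div 2"
    using card_edges_complement[OF assms(2)]
    unfolding ex_number_book[OF assms(1)] assms(3) by linarith
  have cases: "even p \<Longrightarrow> ?H \<simeq> ?M ((p + 2) div 2) \<or> ?H \<simeq> ?P"
    "odd p \<Longrightarrow> ?H \<simeq> complete_graph 1 \<uplus> ?M ((p + 1) div 2)"
    if "card (edges ?H) = (p + 2) div 2"
    using minimal_graph_cases[OF sH] isolated that assms(3) by simp_all
  show ?thesis
  proof (intro conjI impI)
    assume ev: "even p"
    then have "even (p + 2)" by simp
    \<comment> \<open>Writing the named graph as the complement of a matching turns the claim about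
      \<open>G\<close> into one about \<open>?H\<close>.\<close>
    from graph_iso_right_cong[OF complete_minus_pm_iso[OF this], of G]
    have "G \<simeq> complete_minus_pm (p + 2) \<longleftrightarrow> ?H \<simeq> ?M ((p + 2) div 2)"
      unfolding graph_iso_complement_iff[OF assms(2) sM] .
    moreover have "card (edges ?H) = (p + 2) div 2" if "?H \<simeq> ?M ((p + 2) div 2)"
      using graph_iso_card_edges[OF that sH sM] card_edges_copies_complete_2 by simp
    moreover have "card (edges ?H) = (p + 2) div 2" if "?H \<simeq> ?P"
    proof -
      have "card (edges ?H) = (p - 2) div 2 + 2"
        using graph_iso_card_edges[OF that sH sP] unfolding cP .
      \<comment> \<open>Makes \<open>p - 2\<close> exact, so that \<open>(p - 2) div 2 + 2\<close>
        equals \<open>(p + 2) div 2\<close>.\<close>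
      moreover have "p \<ge> 2" using ev assms(1) by presburger
      ultimately show ?thesis by linarith
    qed
    ultimately show "card (edges G) = ex_number (p + 2) (book p) \<longleftrightarrow>
        G \<simeq> complete_minus_pm (p + 2) \<or> G \<simeq> complement ?P"
      using size cases(1) ev graph_iso_complement_iff[OF assms(2) sP] by blast
  next
    assume od: "odd p"
    let ?K = "complete_graph 1 \<uplus> ?M ((p + 1) div 2)"
    from od have "even (p + 1)" by simp
    from graph_iso_right_cong[OF join_complete_minus_pm_iso[OF this], of G]
    have "G \<simeq> join (complete_graph 1) (complete_minus_pm (p + 1)) \<longleftrightarrow> ?H \<simeq> ?K"
      unfolding graph_iso_complement_iff[OF assms(2) sK] .
    moreover have "card (edges ?H) = (p + 2) div 2" if "?H \<simeq> ?K"
    proof -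
      have "card (edges ?H) = (p + 1) div 2"
        using graph_iso_card_edges[OF that sH sK] unfolding cK .
      \<comment> \<open>For odd \<open>p\<close>, \<open>p + 1\<close> is even, and
        \<open>p + 1\<close> and \<open>p + 2\<close> have the same half after rounding
        down.\<close>
      with od show ?thesis by presburger
    qed
    ultimately show "card (edges G) = ex_number (p + 2) (book p) \<longleftrightarrow>
        G \<simeq> join (complete_graph 1) (complete_minus_pm (p + 1))"
      using size cases(2) od by blast
  qed
qed

end
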